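(* Let $\mathcal Q=\{0,1\}^n$, let $h$ be the min-entropy of the target distribution $P(\bm Q\mid\bm e)$ on $\mathcal Q$ (as a function of $n$), and let $\pi_{\mathrm R}$ be the purely random PAC-MAP algorithm described in the context, run with fixed PAC parameters $\varepsilon,\delta\in(0,1)$. Then $\pi_{\mathrm R}$ is tractable if and only if $h=\mathcal O(\log n)$.
   Context: Setting. $\bm Q$ is a random vector of query variables with values in $\mathcal Q=\{0,1\}^n$ and $\bm e$ is fixed evidence; $P(\bm Q\mid\bm e)$ is its conditional distribution with mass function $p(\cdot\mid\bm e)$, and $p^*=\max_{\bm q}p(\bm q\mid\bm e)$. The min-entropy is $h=-\log_2p^*$. A sampler produces i.i.d. draws from $P(\bm Q\mid\bm e)$ and an oracle returns the exact value $p(\bm q\mid\bm e)$ for any $\bm q$, each at constant cost. Asymptotics are over a family of distributions, one for each dimension $n$. A PAC-MAP solver is tractable if its runtime can be upper bounded by a polynomial function of $n$ and $\log(1/\delta)$. (Runtime of $\pi_{\mathrm R}$ is measured by the number of random samples until termination, a bound being required to hold with probability at least $1-\delta$.) Algorithm $\pi_{\mathrm R}$. Start with candidate set $S=\emptyset$, $m=0$, $M=\infty$. While $m<M$: increase $m$ by one; draw $\bm q\sim P(\bm Q\mid\bm e)$ and add it to the set $S$; let $\hat{\bm q}=\arg\max_{\bm q\in S}p(\bm q\mid\bm e)$, $\hat p=p(\hat{\bm q}\mid\bm e)$, and $\check p=1-\sum_{\bm q\in S}p(\bm q\mid\bm e)$. If $\hat p\ge\check p(1-\varepsilon)$, stop;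 otherwise set $M=\hat p^{-1}(1-\varepsilon)\log\delta^{-1}$. On stopping, return $\hat{\bm q},\hat p$. *)

theory Defs
  imports "HOL-Probability.Probability" "HOL-Library.While_Combinator"
    "HOL-Library.Landau_Symbols" "HOL-Computational_Algebra.Polynomial"
begin

definition cube :: "nat \<Rightarrow> bool list set" where
  "cube n = {q. length q = n}"

definition max_prob :: "nat \<Rightarrow> bool list pmf \<Rightarrow> real" where
  "max_prob n P = Max (pmf P ` cube n)"

definition min_entropy :: "nat \<Rightarrow> bool list pmf \<Rightarrow> real" where
  "min_entropy n P = - log 2 (max_prob n P)"

datatype 'q state =
  State (cand: "'q set") (samples: nat) (budget: ereal) (stopped: bool)

definition best :: "'q pmf \<Rightarrow> 'q state \<Rightarrow> 'q" where
  "best P s = arg_max_on (pmf P) (cand s)"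

definition best_prob :: "'q pmf \<Rightarrow> 'q state \<Rightarrow> real" where
  "best_prob P s = pmf P (best P s)"

definition residual :: "'q pmf \<Rightarrow> 'q state \<Rightarrow> real" where
  "residual P s = 1 - (\<Sum>q\<in>cand s. pmf P q)"

definition initial :: "'q state" where
  "initial = State {} 0 \<infinity> False"

text \<open>
  The sequence \<open>\<omega>\<close> supplies the draws: the \<open>m\<close>-th draw of the algorithm is \<open>\<omega> (m - 1)\<close>.
  Logarithms of \<open>1 / \<delta>\<close> are natural. The budget is computed in \<^typ>\<open>ereal\<close>, where
  \<open>inverse 0 = \<infinity>\<close>, so that a candidate of probability zero (drawn with probability zero)
  does not make the budget finite. The last component of \<open>pi_R\<close> is the number of samples drawn.
\<close>

definition iteration ::
  "'q pmf \<Rightarrow> real \<Rightarrow> real \<Rightarrow> (nat \<Rightarrow> 'q) \<Rightarrow> 'q state \<Rightarrow> 'q state" where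
  "iteration P \<epsilon> \<delta> \<omega> s =
    (let s' = State (insert (\<omega> (samples s)) (cand s)) (Suc (samples s)) (budget s) False
     in if best_prob P s' \<ge> residual P s' * (1 - \<epsilon>)
        then State (cand s') (samples s') (budget s') True
        else State (cand s') (samples s')
          (inverse (ereal (best_prob P s')) * ereal ((1 - \<epsilon>) * ln (1 / \<delta>))) False)"

definition running :: "'q state \<Rightarrow> bool" where
  "running s \<longleftrightarrow> \<not> stopped s \<and> ereal (real (samples s)) < budget s"

definition pi_R ::
  "'q pmf \<Rightarrow> real \<Rightarrow> real \<Rightarrow> (nat \<Rightarrow> 'q) \<Rightarrow> (('q \<times> real) \<times> nat) option" where
  "pi_R P \<epsilon> \<delta> \<omega> =
    map_option (\<lambda>s. ((best P s, best_prob P s), samples s))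
      (while_option running (iteration P \<epsilon> \<delta> \<omega>) initial)"

definition runtime :: "'q pmf \<Rightarrow> real \<Rightarrow> real \<Rightarrow> (nat \<Rightarrow> 'q) \<Rightarrow> ereal" where
  "runtime P \<epsilon> \<delta> \<omega> =
    (case pi_R P \<epsilon> \<delta> \<omega> of None \<Rightarrow> \<infinity> | Some (_, m) \<Rightarrow> ereal (real m))"

definition iid :: "'q pmf \<Rightarrow> (nat \<Rightarrow> 'q) measure" where
  "iid P = PiM UNIV (\<lambda>_. measure_pmf P)"

definition poly2 :: "real poly poly \<Rightarrow> real \<Rightarrow> real \<Rightarrow> real" where
  "poly2 f x y = poly (poly f [:y:]) x"

text \<open>
  \<open>D\<close> is the range of confidence parameters over which one and the same polynomial in \<open>n\<close> and
  \<open>log (1 / \<delta>)\<close> has to serve: \<open>D = {\<delta>}\<close> when \<open>\<delta>\<close> is held fixed, and \<open>D = {0<..<1}\<close> when the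
  polynomial dependence on \<open>log (1 / \<delta>)\<close> is required uniformly.
\<close>

definition tractable :: "(nat \<Rightarrow> bool list pmf) \<Rightarrow> real \<Rightarrow> real set \<Rightarrow> bool" where
  "tractable P \<epsilon> D \<longleftrightarrow>
    (\<exists>f. \<forall>\<delta>\<in>D. \<forall>n\<ge>1.
      measure (iid (P n))
        {\<omega> \<in> space (iid (P n)). runtime (P n) \<epsilon> \<delta> \<omega> \<le> ereal (poly2 f (real n) (ln (1 / \<delta>)))}
      \<ge> 1 - \<delta>)"

end

theory Submission
  imports Defs
begin

text \<open>
  After \<open>k\<close> iterations the candidate set consists of the first \<open>k\<close> draws, and a mode enters
  it within about \<open>ln (1 / \<delta>) / p\<^sup>*\<close> draws with probability at least \<open>1 - \<delta>\<close>; from then on the budget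
  is at most this number, so a polynomial bound on \<open>1 / p\<^sup>*\<close> yields tractability. Conversely, if the
  algorithm stops after \<open>k\<close> draws, by either criterion, then some candidate has probability at
  least a constant over \<open>k + 1\<close>. Hence a single run of polynomial length bounds \<open>1 / p\<^sup>*\<close>
  by a polynomial, which is the logarithmic bound on the min-entropy.
\<close>

subsection \<open>Maximal probabilities\<close>

text \<open>\<open>arg_max_on\<close> is a Hilbert choice, so a maximiser must first be shown to
  exist; \<open>Max\<close> of the finite image supplies one.\<close>

lemma arg_max_on_finite:
  fixes f :: "'a \<Rightarrow> 'b::linorder"
  assumes "finite S" "S \<noteq> {}"
  shows "arg_max_on f S \<in> S" and "\<And>x. x \<in> S \<Longrightarrow> f x \<le> f (arg_max_on f S)"
proof -
  have "Max (f ` S) \<in> f ` S"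
    using assms by (intro Max_in) auto
  then obtain y where y: "y \<in> S" "f y = Max (f ` S)"
    by auto
  have "\<exists>y. is_arg_max f (\<lambda>x. x \<in> S) y"
    using y assms by (auto simp: is_arg_max_linorder intro!: exI[of _ y])
  then have "is_arg_max f (\<lambda>x. x \<in> S) (arg_max_on f S)"
    unfolding arg_max_on_def arg_max_def by (rule someI_ex)
  then show "arg_max_on f S \<in> S" "\<And>x. x \<in> S \<Longrightarrow> f x \<le> f (arg_max_on f S)"
    by (auto simp: is_arg_max_linorder)
qed

lemma finite_cube: "finite (cube n)"
  using finite_lists_length_eq[of "UNIV :: bool set" n] by (simp add: cube_def)

lemma max_prob_attained:
  obtains q where "q \<in> cube n" "pmf P q = max_prob n P"
proof -
  have "replicate n True \<in> cube n"
    by (simp add: cube_def)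
  then have "Max (pmf P ` cube n) \<in> pmf P ` cube n"
    using finite_cube by (intro Max_in) auto
  then show ?thesis
    using that by (auto simp: max_prob_def)
qed

text \<open>\<open>max_prob\<close> only looks at the cube; the support hypothesis extends the bound
  to every list, since the mass outside is zero.\<close>

lemma pmf_le_max_prob:
  assumes "set_pmf P \<subseteq> cube n"
  shows "pmf P q \<le> max_prob n P"
proof (cases "q \<in> cube n")
  case True
  then show ?thesis
    by (simp add: max_prob_def finite_cube)
next
  case False
  then have "pmf P q = 0"
    using assms by (auto simp: set_pmf_iff)
  then show ?thesis
    by (metis max_prob_attained pmf_nonneg)
qed

lemma max_prob_pos:
  assumes "set_pmf P \<subseteq> cube n"
  shows "0 < max_prob n P"
  by (metis all_not_in_conv assms less_le_trans pmf_le_max_prob pmf_positive set_pmf_not_empty)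

lemma max_prob_le_1: "max_prob n P \<le> 1"
  by (metis max_prob_attained pmf_le_1)

subsection \<open>Runs of the algorithm\<close>

text \<open>The loop body iterated without its guard, so states beyond termination are defined too.
  \<open>while_option\<close> selects the first of these iterates at which the guard fails.\<close>

definition state_after ::
  "'q pmf \<Rightarrow> real \<Rightarrow> real \<Rightarrow> (nat \<Rightarrow> 'q) \<Rightarrow> nat \<Rightarrow> 'q state" where
  "state_after P \<epsilon> \<delta> \<omega> k = (iteration P \<epsilon> \<delta> \<omega> ^^ k) initial"

lemma state_after_0 [simp]: "state_after P \<epsilon> \<delta> \<omega> 0 = initial"
  by (simp add: state_after_def)

lemma state_after_Suc:
  "state_after P \<epsilon> \<delta> \<omega> (Suc k) = iteration P \<epsilon> \<delta> \<omega> (state_after P \<epsilon> \<delta> \<omega> k)"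
  by (simp add: state_after_def)

lemma samples_state_after [simp]: "samples (state_after P \<epsilon> \<delta> \<omega> k) = k"
  by (induction k) (simp_all add: state_after_Suc initial_def iteration_def Let_def)

lemma cand_state_after [simp]: "cand (state_after P \<epsilon> \<delta> \<omega> k) = \<omega> ` {..<k}"
proof (induction k)
  case 0
  show ?case by (simp add: initial_def)
next
  case (Suc k)
  have "cand (iteration P \<epsilon> \<delta> \<omega> s) = insert (\<omega> (samples s)) (cand s)" for s
    by (simp add: iteration_def Let_def)
  then show ?case
    using Suc by (simp add: state_after_Suc lessThan_Suc)
qed

lemma state_after_cong:
  assumes "\<And>i. i < k \<Longrightarrow> \<omega> i = \<omega>' i"
  shows "state_after P \<epsilon> \<delta> \<omega> k = state_after P \<epsilon> \<delta> \<omega>' k"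
  using assms by (induction k) (simp_all add: state_after_Suc iteration_def Let_def)

text \<open>The loop halts at the least non-running index, so any non-running index, even one past
  termination, bounds the run time from above.\<close>

lemma runtime_le_iff:
  "runtime P \<epsilon> \<delta> \<omega> \<le> ereal r \<longleftrightarrow> (\<exists>k. real k \<le> r \<and> \<not> running (state_after P \<epsilon> \<delta> \<omega> k))"
proof (cases "\<exists>k. \<not> running (state_after P \<epsilon> \<delta> \<omega> k)")
  case True
  define l where "l = (LEAST k. \<not> running (state_after P \<epsilon> \<delta> \<omega> k))"
  have l: "\<not> running (state_after P \<epsilon> \<delta> \<omega> l)"
    unfolding l_def using True by (rule LeastI_ex)
  have l_le: "l \<le> k" if "\<not> running (state_after P \<epsilon> \<delta> \<omega> k)" for k
    unfolding l_def using that by (rule Least_le)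
  have "while_option running (iteration P \<epsilon> \<delta> \<omega>) initial = Some (state_after P \<epsilon> \<delta> \<omega> l)"
    using True unfolding while_option_def state_after_def[symmetric] l_def by simp
  then have "runtime P \<epsilon> \<delta> \<omega> = ereal (real l)"
    by (simp add: runtime_def pi_R_def)
  then show ?thesis
    using l l_le by (auto intro: order_trans[OF of_nat_mono])
next
  case False
  then have "while_option running (iteration P \<epsilon> \<delta> \<omega>) initial = None"
    unfolding while_option_def state_after_def[symmetric] by simp
  then show ?thesis
    using False by (simp add: runtime_def pi_R_def)
qed

lemma best_prob_ge:
  assumes "i < k"
  shows "pmf P (\<omega> i) \<le> best_prob P (state_after P \<epsilon> \<delta> \<omega> k)"
  unfolding best_prob_def best_def using assms by (intro arg_max_on_finite) auto

text \<open>The first \<open>k\<close> draws yield at most \<open>k\<close> distinct candidates,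
  each of mass at most that of the best one.\<close>

lemma residual_ge:
  "1 - real k * best_prob P (state_after P \<epsilon> \<delta> \<omega> k) \<le> residual P (state_after P \<epsilon> \<delta> \<omega> k)"
proof -
  let ?b = "best_prob P (state_after P \<epsilon> \<delta> \<omega> k)"
  have "(\<Sum>q\<in>\<omega> ` {..<k}. pmf P q) \<le> real (card (\<omega> ` {..<k})) * ?b"
    by (intro sum_bounded_above) (auto intro: best_prob_ge)
  also have "\<dots> \<le> real k * ?b"
    using card_image_le[of "{..<k}" \<omega>]
    by (intro mult_right_mono) (auto simp: best_prob_def)
  finally show ?thesis
    by (simp add: residual_def)
qed

text \<open>Each iteration recomputes the flag, and the test depends on the candidates only, so it
  carries over from the intermediate state to the final one.\<close>

lemma stopped_state_afterD:
  assumes "stopped (state_after P \<epsilon> \<delta> \<omega> k)"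
  shows "residual P (state_after P \<epsilon> \<delta> \<omega> k) * (1 - \<epsilon>) \<le> best_prob P (state_after P \<epsilon> \<delta> \<omega> k)"
  using assms
  by (cases k) (auto simp: initial_def state_after_Suc iteration_def Let_def best_prob_def best_def
      residual_def split: if_splits)

lemma budget_state_after:
  assumes "\<not> stopped (state_after P \<epsilon> \<delta> \<omega> k)" "0 < k"
  shows "budget (state_after P \<epsilon> \<delta> \<omega> k) =
    inverse (ereal (best_prob P (state_after P \<epsilon> \<delta> \<omega> k))) * ereal ((1 - \<epsilon>) * ln (1 / \<delta>))"
  using assms
  by (cases k) (auto simp: state_after_Suc iteration_def Let_def best_prob_def best_def
      split: if_splits)

text \<open>A drawn mode is a best candidate. Unless early stopping has occurred, the budget is
  therefore computed from the maximal probability and is at most \<open>k\<close>.\<close>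

lemma not_running_if_mode_drawn:
  assumes mode: "i < k" "\<And>q. pmf P q \<le> pmf P (\<omega> i)"
    and k: "(1 - \<epsilon>) * ln (1 / \<delta>) \<le> real k * pmf P (\<omega> i)"
  shows "\<not> running (state_after P \<epsilon> \<delta> \<omega> k)"
proof (cases "stopped (state_after P \<epsilon> \<delta> \<omega> k)")
  case False
  let ?p = "pmf P (\<omega> i)"
  have "best_prob P (state_after P \<epsilon> \<delta> \<omega> k) = ?p"
    using mode best_prob_ge[of i k P \<omega> \<epsilon> \<delta>] by (intro antisym) (auto simp: best_prob_def)
  moreover have "0 < ?p"
    by (metis mode(2) less_le_trans pmf_positive set_pmf_not_empty all_not_in_conv)
  ultimately have "budget (state_after P \<epsilon> \<delta> \<omega> k) \<le> ereal (real k)"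
    using budget_state_after[OF False] mode(1) k by (simp add: field_simps)
  then show ?thesis
    by (simp add: running_def not_less)
qed (simp add: running_def)

text \<open>With \<open>b\<close> the best probability, early stopping gives
  \<open>1 - \<epsilon> \<le> b + k * b\<close> via \<open>residual_ge\<close>, and an exhausted
  budget gives \<open>(1 - \<epsilon>) * ln (1 / \<delta>) \<le> k * b\<close>. The
  \<open>min\<close> and the \<open>k + 1\<close> cover both exits.\<close>

lemma best_prob_ge_if_not_running:
  assumes "0 < \<epsilon>" "\<epsilon> < 1" "0 < \<delta>" "\<delta> < 1"
    and "\<not> running (state_after P \<epsilon> \<delta> \<omega> k)"
  shows "(1 - \<epsilon>) * min 1 (ln (1 / \<delta>)) \<le> (real k + 1) * best_prob P (state_after P \<epsilon> \<delta> \<omega> k)"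
proof -
  let ?b = "best_prob P (state_after P \<epsilon> \<delta> \<omega> k)"
  have b: "0 \<le> ?b"
    by (simp add: best_prob_def)
  have L: "0 < ln (1 / \<delta>)"
    using assms by simp
  show ?thesis
  proof (cases "stopped (state_after P \<epsilon> \<delta> \<omega> k)")
    case True
    have "(1 - \<epsilon>) * min 1 (ln (1 / \<delta>)) \<le> (1 - \<epsilon>) * 1"
      using assms by (intro mult_left_mono) auto
    also have "\<dots> \<le> (1 - \<epsilon>) * (residual P (state_after P \<epsilon> \<delta> \<omega> k) + real k * ?b)"
      using assms residual_ge[of k P \<epsilon> \<delta> \<omega>] by (intro mult_left_mono) auto
    also have "\<dots> \<le> ?b + 1 * (real k * ?b)"
      unfolding distrib_left using stopped_state_afterD[OF True] assms b
      by (intro add_mono mult_right_mono) (auto simp: mult.commute)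
    finally show ?thesis
      by (simp add: algebra_simps)
  next
    case False
    then have le: "budget (state_after P \<epsilon> \<delta> \<omega> k) \<le> ereal (real k)"
      using assms(5) by (simp add: running_def)
    \<comment> \<open>At \<open>k = 0\<close> the budget is infinite, so the loop would still be
      running.\<close>
    then have "0 < k"
      by (cases "k = 0") (auto simp: initial_def)
    note le = le[unfolded budget_state_after[OF False \<open>0 < k\<close>]]
    \<comment> \<open>If \<open>?b\<close> were zero, its \<open>ereal\<close> inverse would make
      the budget infinite.\<close>
    have "?b \<noteq> 0"
    proof
      assume "?b = 0"
      with le L assms show False
        by simp
    qed
    then have "0 < ?b"
      using b by simp
    then have "(1 - \<epsilon>) * ln (1 / \<delta>) \<le> real k * ?b"
      using le by (simp add: field_simps)
    moreover have "(1 - \<epsilon>) * min 1 (ln (1 / \<delta>)) \<le> (1 - \<epsilon>) * ln (1 / \<delta>)"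
      using assms by (intro mult_left_mono) auto
    ultimately show ?thesis
      using b by (simp add: distrib_right)
  qed
qed

subsection \<open>Measurability and the waiting time for the mode\<close>

lemma product_prob_space_iid: "product_prob_space (\<lambda>_. measure_pmf P)"
  by unfold_locales

lemma prob_space_iid: "prob_space (iid P)"
  unfolding iid_def by (intro prob_space_PiM measure_pmf.prob_space_axioms)

lemma space_iid [simp]: "space (iid P) = UNIV"
  by (auto simp: iid_def space_PiM)

text \<open>Conditions on the first \<open>k\<close> draws are cylinders, whose measurability and
  measure are known for product measures.\<close>

lemma coordinates_eq_prod_emb:
  "{\<omega>. \<forall>i<k. \<omega> i \<in> X i} = prod_emb UNIV (\<lambda>_. measure_pmf P) {..<k} (Pi\<^sub>E {..<k} X)"
  by (rule set_eqI) (simp add: prod_emb_iff Pi_iff Ball_def)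

lemma sets_iid_coordinates:
  "{\<omega>. \<forall>i<k. \<omega> i \<in> X i} \<in> sets (iid P)"
  unfolding iid_def coordinates_eq_prod_emb[where P = P] by (simp add: sets_PiM_I)

lemma measure_iid_coordinates:
  "measure (iid P) {\<omega>. \<forall>i<k. \<omega> i \<in> X i} = (\<Prod>i<k. measure (measure_pmf P) (X i))"
  unfolding iid_def coordinates_eq_prod_emb[where P = P]
  using product_prob_space.measure_PiM_emb[OF product_prob_space_iid, of "{..<k}" UNIV X] by simp

text \<open>A property of the first \<open>k\<close> draws is a union of cylinders indexed by lists,
  and lists over a countable type are countable.\<close>

lemma sets_iid_prefix:
  fixes P :: "'q::countable pmf"
  assumes "\<And>\<omega> \<omega>'. (\<And>i. i < k \<Longrightarrow> \<omega> i = \<omega>' i) \<Longrightarrow> Q \<omega> \<Longrightarrow> Q \<omega>'"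
  shows "{\<omega>. Q \<omega>} \<in> sets (iid P)"
proof -
  \<comment> \<open>Lists of every length may serve as indices: \<open>nth\<close> is total, and
    only its first \<open>k\<close> values affect \<open>Q\<close>.\<close>
  have "{\<omega>. Q \<omega>} = (\<Union>xs\<in>{xs. Q (nth xs)}. {\<omega>. \<forall>i<k. \<omega> i \<in> {xs ! i}})"
  proof (intro set_eqI iffI)
    fix \<omega> assume "\<omega> \<in> {\<omega>. Q \<omega>}"
    then have "Q (nth (map \<omega> [0..<k]))"
      using assms[of \<omega> "nth (map \<omega> [0..<k])"] by simp
    then show "\<omega> \<in> (\<Union>xs\<in>{xs. Q (nth xs)}. {\<omega>. \<forall>i<k. \<omega> i \<in> {xs ! i}})"
      by (auto intro!: exI[of _ "map \<omega> [0..<k]"])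
  next
    fix \<omega> assume "\<omega> \<in> (\<Union>xs\<in>{xs. Q (nth xs)}. {\<omega>. \<forall>i<k. \<omega> i \<in> {xs ! i}})"
    then obtain xs where "Q (nth xs)" "\<And>i. i < k \<Longrightarrow> \<omega> i = xs ! i"
      by auto
    then show "\<omega> \<in> {\<omega>. Q \<omega>}"
      using assms[of "nth xs" \<omega>] by simp
  qed
  also have "\<dots> \<in> sets (iid P)"
    by (intro sets.countable_UN' image_subsetI sets_iid_coordinates countableI_type)
  finally show ?thesis .
qed

lemma sets_runtime_le:
  fixes P :: "'q::countable pmf"
  shows "{\<omega>. runtime P \<epsilon> \<delta> \<omega> \<le> ereal r} \<in> sets (iid P)"
proof -
  have "{\<omega>. runtime P \<epsilon> \<delta> \<omega> \<le> ereal r} =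
      (\<Union>k\<in>{k. real k \<le> r}. {\<omega>. \<not> running (state_after P \<epsilon> \<delta> \<omega> k)})"
    by (auto simp: runtime_le_iff)
  also have "\<dots> \<in> sets (iid P)"
  proof (intro sets.countable_UN' image_subsetI countableI_type)
    fix k
    show "{\<omega>. \<not> running (state_after P \<epsilon> \<delta> \<omega> k)} \<in> sets (iid P)"
      by (rule sets_iid_prefix[of k]) (metis state_after_cong)
  qed
  finally show ?thesis .
qed

text \<open>Independence gives \<open>(1 - pmf P q) ^ k\<close>, and
  \<open>1 - x \<le> exp (- x)\<close>.\<close>

lemma measure_iid_miss_le:
  "measure (iid P) {\<omega>. \<forall>i<k. \<omega> i \<noteq> q} \<le> exp (- real k * pmf P q)"
proof -
  have "measure (iid P) {\<omega>. \<forall>i<k. \<omega> i \<in> - {q}} = (1 - pmf P q) ^ k"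
    unfolding measure_iid_coordinates
    using measure_pmf.prob_compl[of "{q}" P] by (simp add: Compl_eq_Diff_UNIV measure_pmf_single)
  also have "\<dots> \<le> exp (- pmf P q) ^ k"
    using exp_ge_add_one_self[of "- pmf P q"] by (intro power_mono) (auto simp: pmf_le_1)
  also have "\<dots> = exp (- real k * pmf P q)"
    by (simp add: exp_of_nat_mult[symmetric])
  finally show ?thesis
    by simp
qed

text \<open>After \<open>m\<close> draws, with \<open>m\<close> the rounded-up quotient
  \<open>ln (1 / \<delta>) / max_prob n P\<close>, a fixed mode is missed with probability at most
  \<open>\<delta>\<close>. If it is drawn, the same \<open>m\<close> reaches the budget, which is
  smaller by the factor \<open>1 - \<epsilon>\<close>. The summand 1 in the bound on
  \<open>r\<close> absorbs the rounding.\<close>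

lemma measure_runtime_le_ge:
  assumes "set_pmf P \<subseteq> cube n" "0 < \<epsilon>" "\<epsilon> < 1" "0 < \<delta>" "\<delta> < 1"
    and r: "1 + ln (1 / \<delta>) / max_prob n P \<le> r"
  shows "1 - \<delta> \<le> measure (iid P) {\<omega>. runtime P \<epsilon> \<delta> \<omega> \<le> ereal r}"
proof -
  interpret prob_space "iid P"
    by (rule prob_space_iid)
  define p where "p = max_prob n P"
  define m where "m = nat \<lceil>ln (1 / \<delta>) / p\<rceil>"
  obtain q where q: "pmf P q = p"
    using max_prob_attained[of n P] unfolding p_def by blast
  have p: "0 < p" and q_max: "\<And>q'. pmf P q' \<le> pmf P q"
    using max_prob_pos[OF assms(1)] pmf_le_max_prob[OF assms(1)] q by (auto simp: p_def)
  have L: "0 < ln (1 / \<delta>)"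
    using assms by simp
  have m_ge: "ln (1 / \<delta>) \<le> real m * p"
    using p real_nat_ceiling_ge[of "ln (1 / \<delta>) / p"] by (simp add: m_def field_simps)
  have "0 < ln (1 / \<delta>) / p"
    using L p by simp
  then have m_le: "real m \<le> r"
    using r unfolding m_def p_def by linarith
  have "prob {\<omega>. \<forall>i<m. \<omega> i \<noteq> q} \<le> exp (- real m * p)"
    using measure_iid_miss_le[where k = m and P = P and q = q] q by simp
  also have "\<dots> \<le> exp (- ln (1 / \<delta>))"
    using m_ge by simp
  also have "\<dots> = \<delta>"
    using assms by (simp add: ln_div)
  finally have "1 - \<delta> \<le> 1 - prob {\<omega>. \<forall>i<m. \<omega> i \<noteq> q}"
    by simp
  also have "\<dots> = prob (space (iid P) - {\<omega>. \<forall>i<m. \<omega> i \<noteq> q})"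
    using sets_iid_coordinates[of m "\<lambda>_. - {q}" P] by (intro prob_compl[symmetric]) simp
  also have "\<dots> \<le> prob {\<omega>. runtime P \<epsilon> \<delta> \<omega> \<le> ereal r}"
  proof (intro finite_measure_mono sets_runtime_le subsetI)
    fix \<omega> assume "\<omega> \<in> space (iid P) - {\<omega>. \<forall>i<m. \<omega> i \<noteq> q}"
    then obtain i where i: "i < m" "\<omega> i = q"
      by auto
    have "(1 - \<epsilon>) * ln (1 / \<delta>) \<le> 1 * ln (1 / \<delta>)"
      using assms L by (intro mult_right_mono) auto
    then have "\<not> running (state_after P \<epsilon> \<delta> \<omega> m)"
      using i q_max m_ge q by (intro not_running_if_mode_drawn[of i]) auto
    then show "\<omega> \<in> {\<omega>. runtime P \<epsilon> \<delta> \<omega> \<le> ereal r}"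
      using m_le by (auto simp: runtime_le_iff)
  qed
  finally show ?thesis .
qed

text \<open>An event of positive probability contains some \<open>\<omega>\<close>, and one short
  run is enough because the bound on its best candidate is deterministic.\<close>

lemma max_prob_ge_if_runtime_le:
  assumes "set_pmf P \<subseteq> cube n" "0 < \<epsilon>" "\<epsilon> < 1" "0 < \<delta>" "\<delta> < 1"
    and "1 - \<delta> \<le> measure (iid P) {\<omega>. runtime P \<epsilon> \<delta> \<omega> \<le> ereal r}"
  shows "(1 - \<epsilon>) * min 1 (ln (1 / \<delta>)) \<le> (r + 1) * max_prob n P"
proof -
  have "{\<omega>. runtime P \<epsilon> \<delta> \<omega> \<le> ereal r} \<noteq> {}"
    using assms(5,6) by (auto simp del: Collect_empty_eq)
  then obtain \<omega> k where k: "real k \<le> r" "\<not> running (state_after P \<epsilon> \<delta> \<omega> k)"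
    by (auto simp: runtime_le_iff)
  note best_prob_ge_if_not_running[OF assms(2-5) k(2)]
  also have "(real k + 1) * best_prob P (state_after P \<epsilon> \<delta> \<omega> k) \<le> (r + 1) * max_prob n P"
    using k(1) pmf_le_max_prob[OF assms(1)] by (intro mult_mono) (auto simp: best_prob_def)
  finally show ?thesis .
qed

subsection \<open>Polynomial bounds\<close>

text \<open>For \<open>x \<ge> 1\<close> the top power dominates every monomial. A single power is
  what turns into a multiple of \<open>ln x\<close> under the logarithm.\<close>

lemma poly_le_power:
  fixes g :: "real poly"
  assumes "1 \<le> x"
  shows "poly g x \<le> (\<Sum>i\<le>degree g. \<bar>coeff g i\<bar>) * x ^ degree g"
  unfolding poly_altdef sum_distrib_right
proof (intro sum_mono mult_mono)
  fix i assume "i \<in> {..degree g}"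
  then show "x ^ i \<le> x ^ degree g"
    using assms by (intro power_increasing) auto
qed (use assms in auto)

lemma tractable_mono: "D' \<subseteq> D \<Longrightarrow> tractable P \<epsilon> D \<Longrightarrow> tractable P \<epsilon> D'"
  unfolding tractable_def by blast

text \<open>Since \<open>1 / max_prob\<close> is \<open>2 powr min_entropy\<close>, a logarithmic
  entropy bounds it by a power of \<open>n\<close>, and the waiting time for the mode becomes
  polynomial for all \<open>\<delta>\<close> at once.\<close>

lemma tractable_if_min_entropy_bigo:
  assumes "\<And>n. n \<ge> 1 \<Longrightarrow> set_pmf (P n) \<subseteq> cube n" "0 < \<epsilon>" "\<epsilon> < 1"
    and "(\<lambda>n. min_entropy n (P n)) \<in> O(\<lambda>n. ln (real n))"
  shows "tractable P \<epsilon> {0<..<1}"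
proof -
  define ip where "ip n = inverse (max_prob n (P n))" for n
  obtain c where "eventually (\<lambda>n. norm (min_entropy n (P n)) \<le> c * norm (ln (real n))) at_top"
    using assms(4) by (auto elim: landau_o.bigE)
  then obtain N where N: "\<And>n. N \<le> n \<Longrightarrow> norm (min_entropy n (P n)) \<le> c * norm (ln (real n))"
    by (auto simp: eventually_sequentially)
  \<comment> \<open>The exponent comes from \<open>2 powr (c * ln n) = n powr (c * ln 2)\<close>,
    rounded up to a natural number.\<close>
  define k where "k = nat \<lceil>c * ln 2\<rceil>"
  \<comment> \<open>The sum handles the finitely many \<open>n < N\<close>; the leading 1 lets the
    same constant serve for \<open>n \<ge> N\<close>.\<close>
  define B where "B = 1 + (\<Sum>n<N. \<bar>ip n\<bar>)"
  have B: "1 \<le> B"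
    by (simp add: B_def sum_nonneg)
  have ip: "ip n \<le> B * real n ^ k" if n: "1 \<le> n" for n
  proof (cases "n < N")
    case True
    have "ip n \<le> \<bar>ip n\<bar>"
      by simp
    also have "\<dots> \<le> (\<Sum>n<N. \<bar>ip n\<bar>)"
      using True by (intro member_le_sum) auto
    also have "\<dots> \<le> B * 1"
      by (simp add: B_def)
    also have "\<dots> \<le> B * real n ^ k"
      using n B by (intro mult_left_mono one_le_power) auto
    finally show ?thesis .
  next
    case False
    have pos: "0 < max_prob n (P n)"
      using assms(1) n by (intro max_prob_pos)
    have "ip n = 2 powr min_entropy n (P n)"
      using pos by (simp add: ip_def min_entropy_def powr_minus)
    also have "\<dots> \<le> 2 powr (c * ln (real n))"
      using N[of n] False n by (intro powr_mono) auto
    also have "\<dots> = real n powr (c * ln 2)"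
      using n by (simp add: powr_def mult_ac)
    also have "\<dots> \<le> real n powr real k"
      using n real_nat_ceiling_ge[of "c * ln 2"] by (intro powr_mono) (auto simp: k_def)
    also have "\<dots> = 1 * real n ^ k"
      using n by (simp add: powr_realpow)
    also have "\<dots> \<le> B * real n ^ k"
      using B by (intro mult_right_mono) auto
    finally show ?thesis .
  qed
  \<comment> \<open>The outer variable of \<open>f\<close> stands for
    \<open>ln (1 / \<delta>)\<close> and its coefficients are polynomials in \<open>n\<close>, so
    \<open>poly2 f x y = 1 + B * x ^ k * y\<close>.\<close>
  define f where "f = [:1, monom B k:]"
  have "1 - \<delta> \<le> measure (iid (P n))
      {\<omega>. runtime (P n) \<epsilon> \<delta> \<omega> \<le> ereal (poly2 f (real n) (ln (1 / \<delta>)))}"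
    if \<delta>: "0 < \<delta>" "\<delta> < 1" and n: "1 \<le> n" for \<delta> n
  proof (rule measure_runtime_le_ge[OF assms(1)[OF n] assms(2,3) \<delta>])
    have "ln (1 / \<delta>) * ip n \<le> ln (1 / \<delta>) * (B * real n ^ k)"
      using \<delta> ip[OF n] by (intro mult_left_mono) auto
    then show "1 + ln (1 / \<delta>) / max_prob n (P n) \<le> poly2 f (real n) (ln (1 / \<delta>))"
      by (simp add: poly2_def f_def poly_monom ip_def divide_inverse)
  qed
  then show ?thesis
    unfolding tractable_def by (intro exI[of _ f]) auto
qed

text \<open>For fixed \<open>\<delta>\<close> the run time bound is a polynomial in \<open>n\<close>
  alone, so \<open>max_prob\<close> is at least a constant over a polynomial; taking logarithms
  bounds the entropy.\<close>

lemma min_entropy_bigo_if_tractable: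
  assumes "\<And>n. n \<ge> 1 \<Longrightarrow> set_pmf (P n) \<subseteq> cube n"
    and "0 < \<epsilon>" "\<epsilon> < 1" "0 < \<delta>" "\<delta> < 1"
    and "tractable P \<epsilon> {\<delta>}"
  shows "(\<lambda>n. min_entropy n (P n)) \<in> O(\<lambda>n. ln (real n))"
proof -
  define c where "c = (1 - \<epsilon>) * min 1 (ln (1 / \<delta>))"
  have c: "0 < c"
    using assms(2-5) by (simp add: c_def)
  obtain f where f: "\<And>n. 1 \<le> n \<Longrightarrow> 1 - \<delta> \<le> measure (iid (P n))
      {\<omega>. runtime (P n) \<epsilon> \<delta> \<omega> \<le> ereal (poly2 f (real n) (ln (1 / \<delta>)))}"
    using assms(6) by (auto simp: tractable_def)
  \<comment> \<open>The added 1 is the one in \<open>r + 1\<close> of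
    \<open>max_prob_ge_if_runtime_le\<close>.\<close>
  define g where "g = poly f [:ln (1 / \<delta>):] + 1"
  define A where "A = 1 + (\<Sum>i\<le>degree g. \<bar>coeff g i\<bar>)"
  define d where "d = degree g"
  have A: "1 \<le> A"
    by (simp add: A_def sum_nonneg)
  have bound: "norm (min_entropy n (P n)) \<le> \<bar>log 2 (A / c)\<bar> + real d / ln 2 * ln (real n)"
    if n: "1 \<le> n" for n
  proof -
    let ?p = "max_prob n (P n)"
    have p: "0 < ?p" "?p \<le> 1"
      using assms(1)[OF n] by (auto intro: max_prob_pos max_prob_le_1)
    have "c \<le> poly g (real n) * ?p"
      using max_prob_ge_if_runtime_le[OF assms(1)[OF n] assms(2-5) f[OF n]]
      by (simp add: c_def g_def poly2_def)
    also have "\<dots> \<le> (A * real n ^ d) * ?p"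
    proof (intro mult_right_mono)
      show "poly g (real n) \<le> A * real n ^ d"
        using poly_le_power[of "real n" g] n by (simp add: A_def d_def distrib_right add_increasing)
    qed (use p in auto)
    finally have "inverse ?p \<le> A / c * real n ^ d"
      using p c by (simp add: field_simps)
    then have "log 2 (inverse ?p) \<le> log 2 (A / c * real n ^ d)"
      using p by (intro log_mono) auto
    also have "\<dots> = log 2 (A / c) + real d / ln 2 * ln (real n)"
      using A c n by (subst log_mult) (auto simp: log_nat_power log_def[of 2 "real n"])
    finally have "min_entropy n (P n) \<le> log 2 (A / c) + real d / ln 2 * ln (real n)"
      using p by (simp add: min_entropy_def log_inverse)
    moreover have "0 \<le> min_entropy n (P n)"
      using p by (simp add: min_entropy_def)
    ultimately show ?thesis
      by simp
  qed
  have "eventually (\<lambda>n. norm (min_entropy n (P n)) \<le>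
      (\<bar>log 2 (A / c)\<bar> + real d / ln 2) * norm (ln (real n))) at_top"
    \<comment> \<open>From 3 on, \<open>ln n \<ge> 1\<close> because \<open>exp 1 \<le> 3\<close>,
      so the additive constant is absorbed into a multiple of \<open>ln n\<close>.\<close>
    using eventually_ge_at_top[of 3]
  proof eventually_elim
    case (elim n)
    have "exp 1 \<le> real n"
      using exp_le elim by linarith
    then have ln_ge: "1 \<le> ln (real n)"
      using elim by (simp add: ln_ge_iff)
    have "\<bar>log 2 (A / c)\<bar> * 1 \<le> \<bar>log 2 (A / c)\<bar> * ln (real n)"
      using ln_ge by (intro mult_left_mono) auto
    then show ?case
      using bound[of n] elim ln_ge by (simp add: distrib_right)
  qed
  then show ?thesis
    by (rule bigoI)
qed

text \<open>The conjuncts treat the two readings of tractability, for one \<open>\<delta>\<close>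
  and uniformly in \<open>\<delta>\<close>. The base of the logarithm only changes the constant in
  the O-term.\<close>

theorem corollary1p1:
  fixes P :: "nat \<Rightarrow> bool list pmf" and \<epsilon> \<delta> :: real
  assumes "\<And>n. n \<ge> 1 \<Longrightarrow> set_pmf (P n) \<subseteq> cube n"
    and "0 < \<epsilon>" "\<epsilon> < 1" and "0 < \<delta>" "\<delta> < 1"
  shows "(tractable P \<epsilon> {\<delta>} \<longleftrightarrow> (\<lambda>n. min_entropy n (P n)) \<in> O(\<lambda>n. ln (real n))) \<and>
         (tractable P \<epsilon> {0<..<1} \<longleftrightarrow> (\<lambda>n. min_entropy n (P n)) \<in> O(\<lambda>n. ln (real n)))"
proof -
  let ?bigo = "(\<lambda>n. min_entropy n (P n)) \<in> O(\<lambda>n. ln (real n))"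
  \<comment> \<open>The implications form a cycle: uniform tractability, tractability at
    \<open>\<delta>\<close>, entropy bound, uniform tractability.\<close>
  have "tractable P \<epsilon> {0<..<1} \<Longrightarrow> tractable P \<epsilon> {\<delta>}"
    using assms(4,5) by (intro tractable_mono[of "{\<delta>}"]) auto
  moreover have "tractable P \<epsilon> {\<delta>} \<Longrightarrow> ?bigo"
    using assms by (rule min_entropy_bigo_if_tractable)
  moreover have "?bigo \<Longrightarrow> tractable P \<epsilon> {0<..<1}"
    using assms(1-3) by (rule tractable_if_min_entropy_bigo)
  ultimately show ?thesis
    by blast
qed

end
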